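(* Let $R$ be a commutative Artinian ring with identity. Then every nonzero proper ideal $I$ of $R$ is a vertex of $\mathbb{AG}(R)$.
   Context: An ideal $I$ of a commutative ring $R$ is called an annihilating-ideal if there exists a nonzero ideal $J$ of $R$ with $IJ=(0)$. $\mathbb{A}(R)$ denotes the set of all annihilating-ideals of $R$, and $\mathbb{A}(R)^*=\mathbb{A}(R)\setminus\{(0)\}$. The annihilating-ideal graph $\mathbb{AG}(R)$ is the undirected graph with vertex set $\mathbb{A}(R)^*$ in which two distinct vertices $I,J$ are adjacent if and only if $IJ=(0)$. *)

theory Defs
  imports "HOL-Algebra.Ideal_Product" "Graph_Theory.Pair_Digraph"
begin

text \<open>In a commutative ring left, right and two-sided ideals coincide, so the descending
  chain condition can be stated with the two-sided ideals of \<^theory>\<open>HOL-Algebra.Ideal\<close>.\<close>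

locale artinian_cring = cring +
  assumes descending_chain_condition:
    "\<And>C :: nat \<Rightarrow> 'a set. \<lbrakk> \<And>n. ideal (C n) R; \<And>n. C (Suc n) \<subseteq> C n \<rbrakk> \<Longrightarrow> \<exists>N. \<forall>n \<ge> N. C n = C N"

definition annihilating_ideals :: "('a, 'b) ring_scheme \<Rightarrow> 'a set set" where
  "annihilating_ideals R =
    {I. ideal I R \<and> (\<exists>J. ideal J R \<and> J \<noteq> {\<zero>\<^bsub>R\<^esub>} \<and> ideal_prod R I J = {\<zero>\<^bsub>R\<^esub>})}"

text \<open>Undirected graphs are modelled, as usual in \<open>Graph_Theory\<close>, by symmetric digraphs.\<close>

definition annihilating_ideal_graph :: "('a, 'b) ring_scheme \<Rightarrow> 'a set pair_pre_digraph" where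
  "annihilating_ideal_graph R =
    (let V = annihilating_ideals R - {{\<zero>\<^bsub>R\<^esub>}} in
      \<lparr> pverts = V,
        parcs = {(I, J). I \<in> V \<and> J \<in> V \<and> I \<noteq> J \<and> ideal_prod R I J = {\<zero>\<^bsub>R\<^esub>}} \<rparr>)"

lemma (in cring) annihilating_ideal_graph_undirected:
  "pair_bidirected_digraph (annihilating_ideal_graph R)"
proof
  have "(J, I) \<in> parcs (annihilating_ideal_graph R)"
    if "(I, J) \<in> parcs (annihilating_ideal_graph R)" for I J
  proof -
    have "ideal I R" "ideal J R"
      using that by (simp_all add: annihilating_ideal_graph_def annihilating_ideals_def Let_def)
    then have "ideal_prod R J I = ideal_prod R I J"
      by (rule ideal_prod_commute[rotated])
    with that show ?thesis
      by (auto simp: annihilating_ideal_graph_def Let_def)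
  qed
  then have "sym (parcs (annihilating_ideal_graph R))"
    by (rule symI)
  then show "symmetric (with_proj (annihilating_ideal_graph R))"
    by (simp add: symmetric_def arcs_ends_def arc_to_ends_def)
qed (simp_all add: annihilating_ideal_graph_def Let_def split: prod.splits)

end

theory Submission
  imports Defs "HOL-Algebra.Multiplicative_Group"
begin

text \<open>Choose \<open>y \<in> I\<close> such that the principal ideal \<open>(1 - y)\<close> is minimal among those of this
  form. It is nonzero because \<open>I\<close> is proper, and minimality makes multiplication by every \<open>1 - z\<close>
  with \<open>z \<in> I\<close> invertible on it. A minimal nonzero ideal \<open>J \<subseteq> (1 - y)\<close> is then annihilated by
  \<open>I\<close>: if \<open>x z \<noteq> 0\<close> with \<open>x \<in> J\<close> and \<open>z \<in> I\<close>, then \<open>x\<close> lies in \<open>(x z) = J\<close>, say \<open>x = r x z\<close>, so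
  \<open>x (1 - r z) = 0\<close> and hence \<open>x = 0\<close>.\<close>

text \<open>Without a minimal member, repeatedly choosing a strictly smaller one would give a
  strictly descending chain of ideals that never stabilizes.\<close>

lemma (in artinian_cring) minimal_ideal_in_family:
  assumes "A \<noteq> {}" and ideals: "\<And>K. K \<in> A \<Longrightarrow> ideal K R"
  shows "\<exists>L\<in>A. \<forall>K\<in>A. K \<subseteq> L \<longrightarrow> K = L"
proof (rule ccontr)
  assume "\<not> ?thesis"
  then have "\<forall>L\<in>A. \<exists>K\<in>A. K \<subset> L"
    by blast
  then obtain f where f: "\<And>L. L \<in> A \<Longrightarrow> f L \<in> A \<and> f L \<subset> L"
    by metis
  obtain L where "L \<in> A"
    using \<open>A \<noteq> {}\<close> by blast
  define C where "C n = (f ^^ n) L" for n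
  have C: "C n \<in> A" for n
    by (induction n) (simp_all add: C_def \<open>L \<in> A\<close> f)
  have less: "C (Suc n) \<subset> C n" for n
    using f[OF C[of n]] by (simp add: C_def)
  obtain N where "\<forall>n\<ge>N. C n = C N"
    using descending_chain_condition[of C] ideals[OF C] less by blast
  with less[of N] show False
    by (metis le_SucI order_refl psubset_eq)
qed

lemma (in artinian_cring) proper_ideal_annihilated_by_nonzero_ideal:
  assumes "ideal I R" and "I \<noteq> carrier R"
  obtains J where "ideal J R" and "J \<noteq> {\<zero>}" and "ideal_prod R I J = {\<zero>}"
proof -
  interpret I: ideal I R
    by fact
  have one: "\<one> \<notin> I"
    using I.one_imp_carrier \<open>I \<noteq> carrier R\<close> by blast
  define A where "A = (\<lambda>y. PIdl (\<one> \<ominus> y)) ` I"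
  have "A \<noteq> {}"
    unfolding A_def using I.zero_closed by blast
  moreover have "ideal K R" if "K \<in> A" for K
    using that I.Icarr unfolding A_def by (auto intro!: cgenideal_ideal)
  ultimately have "\<exists>L\<in>A. \<forall>K\<in>A. K \<subseteq> L \<longrightarrow> K = L"
    by (rule minimal_ideal_in_family)
  then obtain L where "L \<in> A" and L_min: "\<And>K. \<lbrakk> K \<in> A; K \<subseteq> L \<rbrakk> \<Longrightarrow> K = L"
    by blast
  then obtain y where y: "y \<in> I" and L_def: "L = PIdl (\<one> \<ominus> y)"
    unfolding A_def by blast
  have y_carrier [simp]: "y \<in> carrier R"
    using y by (rule I.Icarr)
  have L: "ideal L R"
    unfolding L_def by (simp add: cgenideal_ideal)
  have "\<one> \<ominus> y \<noteq> \<zero>"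
    using one y by auto
  moreover have "\<one> \<ominus> y \<in> L"
    unfolding L_def by (simp add: cgenideal_self)
  ultimately have L_nonzero: "L \<noteq> {\<zero>}"
    by blast
  \<comment> \<open>The minimality of \<open>L\<close> enters here: it makes multiplication by
    \<open>\<one> \<ominus> z\<close> injective on \<open>L\<close>.\<close>
  have cancel: "x = \<zero>" if "x \<in> L" and z: "z \<in> I" and x0: "x \<otimes> (\<one> \<ominus> z) = \<zero>" for x z
  proof -
    have z_carrier [simp]: "z \<in> carrier R"
      using z by (rule I.Icarr)
    obtain t where t [simp]: "t \<in> carrier R" and x: "x = t \<otimes> (\<one> \<ominus> y)"
      using \<open>x \<in> L\<close> by (auto simp: L_def cgenideal_def)
    \<comment> \<open>Chosen so that \<open>\<one> \<ominus> w\<close> factors as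
      \<open>(\<one> \<ominus> z) \<otimes> (\<one> \<ominus> y)\<close>; its principal ideal then
      belongs to \<open>A\<close> and lies in \<open>L\<close>, hence equals
      \<open>L\<close>.\<close>
    define w where "w = y \<oplus> z \<ominus> y \<otimes> z"
    have "w \<in> I"
      unfolding w_def a_minus_def using y z by (simp add: I.I_r_closed)
    then have "PIdl (\<one> \<ominus> w) \<in> A"
      unfolding A_def by (rule imageI)
    moreover have w: "\<one> \<ominus> w = (\<one> \<ominus> z) \<otimes> (\<one> \<ominus> y)"
      unfolding w_def using y_carrier z_carrier by algebra
    moreover have "PIdl (\<one> \<ominus> w) \<subseteq> L"
      unfolding w using L \<open>\<one> \<ominus> y \<in> L\<close> by (intro cgenideal_minimal ideal.I_l_closed) simp_all
    ultimately have "PIdl (\<one> \<ominus> w) = L"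
      by (intro L_min)
    then obtain s where s [simp]: "s \<in> carrier R" and "\<one> \<ominus> y = s \<otimes> ((\<one> \<ominus> z) \<otimes> (\<one> \<ominus> y))"
      using \<open>\<one> \<ominus> y \<in> L\<close> unfolding w by (auto simp: cgenideal_def)
    \<comment> \<open>Substituting this expression for \<open>\<one> \<ominus> y\<close> turns
      \<open>x\<close> into a multiple of \<open>x \<otimes> (\<one> \<ominus> z)\<close>, which
      vanishes.\<close>
    then have "x = t \<otimes> (s \<otimes> ((\<one> \<ominus> z) \<otimes> (\<one> \<ominus> y)))"
      using x by simp
    also have "\<dots> = s \<otimes> (x \<otimes> (\<one> \<ominus> z))"
      unfolding x by (simp add: m_ac)
    finally show ?thesis
      using x0 by simp
  qed
  \<comment> \<open>A minimal member of \<open>B\<close> is a minimal nonzero ideal of the whole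
    ring, since every ideal below it also lies in \<open>L\<close>.\<close>
  define B where "B = {K. ideal K R \<and> K \<noteq> {\<zero>} \<and> K \<subseteq> L}"
  have "B \<noteq> {}"
    unfolding B_def using L L_nonzero by blast
  moreover have "ideal K R" if "K \<in> B" for K
    using that unfolding B_def by blast
  ultimately have "\<exists>L\<in>B. \<forall>K\<in>B. K \<subseteq> L \<longrightarrow> K = L"
    by (rule minimal_ideal_in_family)
  then obtain J where "J \<in> B" and J_min: "\<And>K. \<lbrakk> K \<in> B; K \<subseteq> J \<rbrakk> \<Longrightarrow> K = J"
    by blast
  then have J: "ideal J R" and "J \<noteq> {\<zero>}" and "J \<subseteq> L"
    unfolding B_def by auto
  interpret J: ideal J R
    by fact
  have zero: "z \<otimes> x = \<zero>" if z: "z \<in> I" and x: "x \<in> J" for z x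
  proof (rule ccontr)
    assume nonzero: "z \<otimes> x \<noteq> \<zero>"
    have carrier [simp]: "z \<in> carrier R" "x \<in> carrier R"
      using z x by (auto intro: I.Icarr J.Icarr)
    have "PIdl (z \<otimes> x) \<subseteq> J"
      using J x by (intro cgenideal_minimal J.I_l_closed) simp_all
    moreover have "z \<otimes> x \<in> PIdl (z \<otimes> x)"
      by (simp add: cgenideal_self)
    with nonzero have "PIdl (z \<otimes> x) \<noteq> {\<zero>}"
      by blast
    moreover have "ideal (PIdl (z \<otimes> x)) R"
      by (simp add: cgenideal_ideal)
    ultimately have "PIdl (z \<otimes> x) = J"
      using \<open>J \<subseteq> L\<close> by (intro J_min) (auto simp: B_def)
    then obtain r where [simp]: "r \<in> carrier R" and r: "x = r \<otimes> (z \<otimes> x)"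
      using x by (auto simp: cgenideal_def)
    \<comment> \<open>Since \<open>r \<otimes> z\<close> is again in \<open>I\<close>,
      \<open>cancel\<close> applies with it in place of \<open>z\<close>.\<close>
    have "x \<otimes> (\<one> \<ominus> r \<otimes> z) = x \<ominus> r \<otimes> (z \<otimes> x)"
      using carrier \<open>r \<in> carrier R\<close> by algebra
    also have "\<dots> = \<zero>"
      unfolding r[symmetric] by simp
    finally have "x = \<zero>"
      using cancel[of x "r \<otimes> z"] I.I_l_closed[of z r] x z \<open>J \<subseteq> L\<close> by auto
    with nonzero show False
      by simp
  qed
  \<comment> \<open>The ideal product is generated inductively by products and sums, so the
    vanishing of products suffices.\<close>
  have "x = \<zero>" if "x \<in> ideal_prod R I J" for x
    using that by induction (simp_all add: zero)
  moreover have "\<zero> \<in> ideal_prod R I J"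
    using ideal_prod_is_ideal[OF \<open>ideal I R\<close> J]
    by (simp add: additive_subgroup.zero_closed ideal.axioms(1))
  ultimately have "ideal_prod R I J = {\<zero>}"
    by blast
  with J \<open>J \<noteq> {\<zero>}\<close> show thesis
    by (rule that)
qed

theorem proposition1p3:
  fixes R :: "('a, 'b) ring_scheme" (structure)
  assumes "artinian_cring R"
    and "ideal I R" and "I \<noteq> {\<zero>}" and "I \<noteq> carrier R"
  shows "I \<in> pverts (annihilating_ideal_graph R)"
proof -
  obtain J where "ideal J R" "J \<noteq> {\<zero>}" "ideal_prod R I J = {\<zero>}"
    using artinian_cring.proper_ideal_annihilated_by_nonzero_ideal assms(1,2,4) by blast
  with assms show ?thesis
    by (auto simp: annihilating_ideal_graph_def annihilating_ideals_def)
qed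

end
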